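(* Let $n\ge 1$ and let $f:\mathbb R^n\to\mathbb R$ satisfy the standing assumptions (A1)–(A3) stated in the context. Let $J\subset(0,\infty)$ be an interval and let $x:J\to\mathbb R^n$ be a critical-point branch of $P_tf$ on $J$. Define $E(t):=(P_tf)(x_t)$ for $t\in J$. Then $E\in C^1(J)$ and $$E'(t)=\partial_t(P_tf)(x_t)=\Delta(P_tf)(x_t)\qquad\text{for all }t\in J,$$ where $\partial_t(P_tf)(x_t)$ and $\Delta(P_tf)(x_t)$ denote the partial derivative in $t$ and the Laplacian in $x$ of the function $(t,x)\mapsto(P_tf)(x)$, evaluated at $(t,x_t)$.
   Context: Notation: $\|\cdot\|_2$ is the Euclidean norm on $\mathbb R^n$ and $B_\rho(0)=\{x:\|x\|_2<\rho\}$. For $t>0$ the heat kernel is $G_t(y)=\frac{1}{(4\pi t)^{n/2}}e^{-\|y\|_2^2/(4t)}$, and the heat-kernel regularization of $f$ is $(P_tf)(x)=\int_{\mathbb R^n}G_t(x-y)f(y)\,dy$. For $a\in[1,2]$, $\Phi_a(x)=\sum_{i=1}^n|x_i|^a$. Definition: for an interval $J\subset(0,\infty)$, a critical-point branch of $P_tf$ on $J$ is a map $x\in C^1(J;\mathbb R^n)$ with $\nabla_x(P_tf)(x_t)=0$ for all $t\in J$. Standing assumptions on the (Lebesgue measurable) function $f:\mathbb R^n\to\mathbb R$: (A1) Global quadratic lower bound: there is a constant $c>0$ with $f(x)\ge c\|x\|_2^2$ for all $x\in\mathbb R^n$. The distinguished minimizer is at the origin, with $f(0)=0$. (A2) Local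 leading-order profile: there exist $a\in[1,2]$, $r_0>0$, a function $r:\mathbb R^n\to\mathbb R$ and a function $\omega:[0,r_0)\to[0,\infty)$ with $\lim_{\rho\to0^+}\omega(\rho)=0$ such that $f(x)=\Phi_a(x)+r(x)$ and $|r(x)|\le\omega(\|x\|_2)\,\Phi_a(x)$ for all $x\in B_{r_0}(0)$. (A3) Polynomial tail control: there exist constants $C>0$ and $m\ge2$ such that $f(x)\le C(1+\|x\|_2^m)$ for all $x\in\mathbb R^n$. *)

theory Defs
  imports "HOL-Analysis.Analysis"
begin

definition heat_kernel :: "real \<Rightarrow> real ^ 'n \<Rightarrow> real" where
  "heat_kernel t y =
     1 / (4 * pi * t) powr (real CARD('n) / 2) * exp (- (norm y)\<^sup>2 / (4 * t))"

definition heat_reg :: "real \<Rightarrow> (real ^ 'n \<Rightarrow> real) \<Rightarrow> real ^ 'n \<Rightarrow> real" where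
  "heat_reg t f x = (LINT y|lebesgue. heat_kernel t (x - y) * f y)"

definition Phi :: "real \<Rightarrow> real ^ 'n \<Rightarrow> real" where
  "Phi a x = (\<Sum>i\<in>UNIV. \<bar>x $ i\<bar> powr a)"


definition quadratic_lower_bound :: "(real ^ 'n \<Rightarrow> real) \<Rightarrow> bool" where
  "quadratic_lower_bound f \<longleftrightarrow> (\<exists>c>0. \<forall>x. f x \<ge> c * (norm x)\<^sup>2) \<and> f 0 = 0"

(* Only the values of omega on [0, r0) matter. *)
definition local_profile :: "(real ^ 'n \<Rightarrow> real) \<Rightarrow> bool" where
  "local_profile f \<longleftrightarrow>
     (\<exists>a\<in>{1..2}. \<exists>r0>0. \<exists>(r :: real ^ 'n \<Rightarrow> real) (\<omega> :: real \<Rightarrow> real).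
        (\<forall>\<rho>\<in>{0..<r0}. \<omega> \<rho> \<ge> 0) \<and> (\<omega> \<longlongrightarrow> 0) (at_right 0) \<and>
        (\<forall>x\<in>ball 0 r0. f x = Phi a x + r x \<and> \<bar>r x\<bar> \<le> \<omega> (norm x) * Phi a x))"

definition polynomial_tail :: "(real ^ 'n \<Rightarrow> real) \<Rightarrow> bool" where
  "polynomial_tail f \<longleftrightarrow>
     (\<exists>C>0. \<exists>m\<ge>2. \<forall>x. f x \<le> C * (1 + norm x powr m))"


(* Derivatives are taken within J, hence one-sided at an endpoint belonging to J;
   C1_differentiable_on would require two-sided derivatives there. *)
definition C1_on :: "real set \<Rightarrow> (real \<Rightarrow> 'a::real_normed_vector) \<Rightarrow> bool" where
  "C1_on J g \<longleftrightarrow>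
     (\<exists>g'. continuous_on J g' \<and>
           (\<forall>t\<in>J. (g has_vector_derivative g' t) (at t within J)))"

definition critical_point_branch ::
    "(real ^ 'n \<Rightarrow> real) \<Rightarrow> real set \<Rightarrow> (real \<Rightarrow> real ^ 'n) \<Rightarrow> bool" where
  "critical_point_branch f J x \<longleftrightarrow>
     C1_on J x \<and> (\<forall>t\<in>J. GDERIV (heat_reg t f) (x t) :> 0)"


definition partial_deriv :: "'n \<Rightarrow> (real ^ 'n \<Rightarrow> real) \<Rightarrow> real ^ 'n \<Rightarrow> real" where
  "partial_deriv i g x = deriv (\<lambda>s. g (x + s *\<^sub>R axis i 1)) 0"

definition laplacian :: "(real ^ 'n \<Rightarrow> real) \<Rightarrow> real ^ 'n \<Rightarrow> real" where
  "laplacian g x = (\<Sum>i\<in>UNIV. partial_deriv i (partial_deriv i g) x)"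

(* Existence of the derivatives occurring in laplacian g x; without it the total
   operator deriv returns arbitrary values. *)
definition has_pure_second_partials :: "(real ^ 'n \<Rightarrow> real) \<Rightarrow> real ^ 'n \<Rightarrow> bool" where
  "has_pure_second_partials g x \<longleftrightarrow>
     (\<forall>i. (\<forall>\<^sub>F y in nhds x. (\<lambda>s. g (y + s *\<^sub>R axis i 1)) differentiable (at 0)) \<and>
          (\<lambda>s. partial_deriv i g (x + s *\<^sub>R axis i 1)) differentiable (at 0))"

end

theory Submission
  imports Defs "HOL-Probability.Distributions"
begin

text \<open>Write u(t, y) for the heat regularization of f. By (A1) and (A3), f is nonnegative and
  of at most polynomial growth, hence integrable against every centred Gaussian
  (\<open>gauss_integrable_polynomial_tail\<close>). The heat kernel and its derivatives of first
  order in t and of order at most two along an axis are polynomials in the space variable times the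
  kernel. Near each (t, x) with t > 0, one integrable function dominates all these integrands
  (\<open>heat_dominated_integrable_bound\<close>), so differentiation passes under the integral
  (\<open>heat_conv_has_derivative_along\<close>) and the results are jointly continuous
  (\<open>continuous_on_heat_conv\<close>).

  The kernel solves the heat equation (\<open>sum_heat_kernel_dxx\<close>), so the time derivative
  and the Laplacian of u are the same function W, namely \<open>heat_conv heat_kernel_dt f\<close>.
  Along a branch the chain rule would give W(t, x t) plus the gradient of u paired with the velocity
  of x; the gradient vanishes at x t, which leaves W(t, x t) (\<open>heat_reg_along_branch\<close>).
  Since W and x are continuous, so is this derivative, and E is C1.\<close>

section \<open>Limits and derivatives under the integral sign\<close>

text \<open>Tested along sequences, this is ordinary dominated convergence; the domination holds
  only eventually, so each sequence is shifted by some \<open>N\<close>. The general parameter type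
  serves both difference quotients in a real s and limits in the pair (t, x).\<close>

lemma tendsto_integral_dominated:
  fixes k :: "'b::first_countable_topology \<Rightarrow> 'a \<Rightarrow> real"
  assumes ev: "\<forall>\<^sub>F s in at a within S. k s \<in> borel_measurable M \<and> (\<forall>y. \<bar>k s y\<bar> \<le> g y)"
    and k0: "k0 \<in> borel_measurable M" and g: "integrable M g"
    and lim: "\<And>y. ((\<lambda>s. k s y) \<longlongrightarrow> k0 y) (at a within S)"
  shows "((\<lambda>s. LINT y|M. k s y) \<longlongrightarrow> (LINT y|M. k0 y)) (at a within S)"
  unfolding tendsto_at_iff_sequentially
proof (intro allI impI)
  fix X assume X: "\<forall>i. X i \<in> S - {a}" "X \<longlonglongrightarrow> a"
  then have X': "filterlim X (at a within S) sequentially"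
    by (auto simp: filterlim_at)
  from filterlim_iff[THEN iffD1, OF X', rule_format, OF ev]
  obtain N where N: "\<And>n. N \<le> n \<Longrightarrow> k (X n) \<in> borel_measurable M \<and> (\<forall>y. \<bar>k (X n) y\<bar> \<le> g y)"
    by (auto simp: eventually_sequentially)
  have "(\<lambda>n. LINT y|M. k (X (n + N)) y) \<longlonglongrightarrow> (LINT y|M. k0 y)"
  proof (rule integral_dominated_convergence[where w=g])
    show "AE y in M. (\<lambda>n. k (X (n + N)) y) \<longlonglongrightarrow> k0 y"
    proof (rule AE_I2)
      fix y
      have "(\<lambda>n. k (X n) y) \<longlonglongrightarrow> k0 y"
        by (rule filterlim_compose[OF lim X'])
      then show "(\<lambda>n. k (X (n + N)) y) \<longlonglongrightarrow> k0 y"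
        by (rule LIMSEQ_ignore_initial_segment)
    qed
  qed (use k0 g N in auto)
  then show "((\<lambda>s. LINT y|M. k s y) \<circ> X) \<longlonglongrightarrow> (LINT y|M. k0 y)"
    unfolding comp_def by (rule LIMSEQ_offset)
qed

text \<open>By the mean value inequality, a bound \<open>g\<close> on the derivative in s near
  \<open>a\<close> also bounds the difference quotients at \<open>a\<close>, so dominated
  convergence applies to them.\<close>

lemma has_real_derivative_integral_dominated:
  fixes k :: "real \<Rightarrow> 'a \<Rightarrow> real"
  assumes \<delta>: "\<delta> > 0" and g: "integrable M g"
    and int: "\<And>s. \<bar>s - a\<bar> < \<delta> \<Longrightarrow> integrable M (k s)"
    and der: "\<And>s y. \<bar>s - a\<bar> < \<delta> \<Longrightarrow> ((\<lambda>s. k s y) has_real_derivative k' s y) (at s)"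
    and bnd: "\<And>s y. \<bar>s - a\<bar> < \<delta> \<Longrightarrow> \<bar>k' s y\<bar> \<le> g y"
    and k': "k' a \<in> borel_measurable M"
  shows "((\<lambda>s. LINT y|M. k s y) has_real_derivative (LINT y|M. k' a y)) (at a)"
proof -
  have near: "\<forall>\<^sub>F s in at a. \<bar>s - a\<bar> < \<delta> \<and> s \<noteq> a"
    using \<delta> unfolding eventually_at by (auto simp: dist_real_def)
  have "((\<lambda>s. LINT y|M. (k s y - k a y) / (s - a)) \<longlongrightarrow> (LINT y|M. k' a y)) (at a)"
  proof (rule tendsto_integral_dominated[OF _ k' g])
    show "\<forall>\<^sub>F s in at a. (\<lambda>y. (k s y - k a y) / (s - a)) \<in> borel_measurable M \<and>
            (\<forall>y. \<bar>(k s y - k a y) / (s - a)\<bar> \<le> g y)"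
      using near
    proof eventually_elim
      case (elim s)
      have "\<bar>(k s y - k a y) / (s - a)\<bar> \<le> g y" for y
      proof -
        have "norm (k s y - k a y) \<le> g y * norm (s - a)"
        proof (rule field_differentiable_bound[where S="{s. \<bar>s - a\<bar> < \<delta>}" and f'="\<lambda>s. k' s y"])
          have "{s. \<bar>s - a\<bar> < \<delta>} = ball a \<delta>"
            by (auto simp: dist_real_def)
          then show "convex {s. \<bar>s - a\<bar> < \<delta>}" by simp
        qed (use elim \<delta> der bnd in \<open>auto intro: has_field_derivative_at_within\<close>)
        then show ?thesis using elim by (simp add: field_simps)
      qed
      moreover have "integrable M (k s)" "integrable M (k a)"
        using elim \<delta> by (auto intro: int)
      ultimately show ?case by auto
    qed
    show "((\<lambda>s. (k s y - k a y) / (s - a)) \<longlongrightarrow> k' a y) (at a)" for y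
      using der[of a y] \<delta> by (simp add: has_field_derivative_iff)
  qed
  moreover have "\<forall>\<^sub>F s in at a. (LINT y|M. (k s y - k a y) / (s - a)) =
      ((LINT y|M. k s y) - (LINT y|M. k a y)) / (s - a)"
    using near by eventually_elim (use \<delta> in \<open>auto simp: int\<close>)
  ultimately show ?thesis
    unfolding has_field_derivative_iff by (rule Lim_transform_eventually)
qed

section \<open>Integrability of f against Gaussians\<close>

text \<open>The Gaussian is a product of one-dimensional factors, one for each basis vector, so
  Tonelli reduces the claim to the line.\<close>

lemma integrable_gaussian:
  fixes \<epsilon> :: real
  assumes "\<epsilon> > 0"
  shows "integrable lborel (\<lambda>y::'a::euclidean_space. exp (- \<epsilon> * (norm y)\<^sup>2))"
proof -
  define h where "h z = exp (- \<epsilon> * z\<^sup>2)" for z :: real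
  have [measurable]: "h \<in> borel_measurable borel" unfolding h_def by measurable
  \<comment> \<open>The normal density with variance 1/(2 \<epsilon>) has exponent - \<epsilon> z^2;
    the square root cancels its normalization.\<close>
  have "h = (\<lambda>z. sqrt (2 * pi * (1 / sqrt (2*\<epsilon>))\<^sup>2) * normal_density 0 (1 / sqrt (2*\<epsilon>)) z)"
    using assms by (auto simp: h_def normal_density_def power_divide fun_eq_iff)
  then have "integrable lborel h"
    using assms by simp
  then have fin: "(\<integral>\<^sup>+x. ennreal (h x) \<partial>lborel) < \<infinity>"
    by (simp add: integrable_iff_bounded h_def)
  have prod: "exp (- \<epsilon> * (norm y)\<^sup>2) = (\<Prod>b\<in>Basis. h (y \<bullet> b))" for y :: 'a
    unfolding power2_norm_eq_inner euclidean_inner[of y y] h_def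
    by (simp add: exp_sum[symmetric] sum_distrib_left sum_negf power2_eq_square)
  have "(\<integral>\<^sup>+y. ennreal (exp (- \<epsilon> * (norm y)\<^sup>2)) \<partial>(lborel :: 'a measure)) =
      (\<integral>\<^sup>+y. (\<Prod>b\<in>Basis. ennreal (h (y \<bullet> b))) \<partial>(lborel :: 'a measure))"
    unfolding prod by (subst prod_ennreal) (auto simp: h_def)
  also have "\<dots> = (\<Prod>b\<in>(Basis::'a set). (\<integral>\<^sup>+x. ennreal (h x) \<partial>lborel))"
    by (rule nn_integral_lborel_prod) auto
  also have "\<dots> < \<infinity>"
    using fin by (auto simp: ennreal_prod_eq_top power_eq_top_ennreal less_top[symmetric])
  finally show ?thesis
    by (simp add: integrable_iff_bounded)
qed

text \<open>This is the form in which the growth of f enters the later estimates. All \<epsilon> are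
  required because the kernel at a large time t decays only like a Gaussian with small coefficient
  1/(4 t).\<close>

definition gauss_integrable :: "(real ^ 'n \<Rightarrow> real) \<Rightarrow> bool" where
  "gauss_integrable f \<longleftrightarrow> f \<in> borel_measurable lebesgue \<and>
     (\<forall>\<epsilon>>0. integrable lebesgue (\<lambda>y. exp (- \<epsilon> * (norm y)\<^sup>2) * f y))"

text \<open>From ln r <= r one gets r^m <= exp(m r), and completing the square bounds m r by m^2/(4
  \<epsilon>) + \<epsilon> r^2.\<close>

lemma one_plus_powr_le_gaussian:
  fixes \<epsilon> m r :: real
  assumes "\<epsilon> > 0" "m > 0" "r \<ge> 0"
  shows "1 + r powr m \<le> (1 + exp (m\<^sup>2 / (4 * \<epsilon>))) * exp (\<epsilon> * r\<^sup>2)"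
proof -
  have "r powr m \<le> exp (m * r)"
  proof (cases "r = 0")
    case False
    then have "m * ln r \<le> m * r"
      using assms by (intro mult_left_mono) (auto intro: less_imp_le ln_less_self)
    then show ?thesis using False by (simp add: powr_def)
  qed simp
  also have "\<dots> \<le> exp (m\<^sup>2 / (4 * \<epsilon>) + \<epsilon> * r\<^sup>2)"
  proof -
    have "0 \<le> (m - 2 * \<epsilon> * r)\<^sup>2 / (4 * \<epsilon>)" using assms by simp
    also have "\<dots> = m\<^sup>2 / (4 * \<epsilon>) + \<epsilon> * r\<^sup>2 - m * r"
      using assms by (simp add: field_simps power2_eq_square)
    finally show ?thesis by simp
  qed
  finally have "r powr m \<le> exp (m\<^sup>2 / (4 * \<epsilon>)) * exp (\<epsilon> * r\<^sup>2)"
    by (simp add: exp_add)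
  moreover have "1 \<le> exp (\<epsilon> * r\<^sup>2)" using assms by simp
  ultimately show ?thesis unfolding distrib_right by linarith
qed

text \<open>The lower bound makes f nonnegative, so the upper bound controls its absolute value.
  Half of the Gaussian exponent absorbs the polynomial growth and the other half is
  integrable.\<close>

lemma gauss_integrable_polynomial_tail:
  fixes f :: "real ^ 'n \<Rightarrow> real"
  assumes f: "f \<in> borel_measurable lebesgue"
    and "quadratic_lower_bound f" "polynomial_tail f"
  shows "gauss_integrable f"
  unfolding gauss_integrable_def
proof (intro conjI allI impI f)
  fix \<epsilon> :: real assume \<epsilon>: "\<epsilon> > 0"
  have f0: "f x \<ge> 0" for x
    using assms(2) unfolding quadratic_lower_bound_def
    by (meson dual_order.trans less_imp_le mult_nonneg_nonneg zero_le_power2)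
  obtain C m where C: "C > 0" "m \<ge> 2" "\<And>x. f x \<le> C * (1 + norm x powr m)"
    using assms(3) unfolding polynomial_tail_def by auto
  \<comment> \<open>The exponent m^2/(2 \<epsilon>) is that of
    \<open>one_plus_powr_le_gaussian\<close> taken at \<epsilon>/2.\<close>
  define B where "B = C * (1 + exp (m\<^sup>2 / (2 * \<epsilon>)))"
  have "integrable lebesgue (\<lambda>y::real^'n. B * exp (- (\<epsilon>/2) * (norm y)\<^sup>2))"
    using integrable_gaussian[of "\<epsilon>/2"] \<epsilon>
    by (intro integrable_mult_right) (simp add: integrable_completion)
  then show "integrable lebesgue (\<lambda>y. exp (- \<epsilon> * (norm y)\<^sup>2) * f y)"
  proof (rule Bochner_Integration.integrable_bound)
    show "(\<lambda>y. exp (- \<epsilon> * (norm y)\<^sup>2) * f y) \<in> borel_measurable lebesgue"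
      by (intro borel_measurable_times f measurable_completion) measurable
    show "AE y in lebesgue. norm (exp (- \<epsilon> * (norm y)\<^sup>2) * f y)
        \<le> norm (B * exp (- (\<epsilon>/2) * (norm y)\<^sup>2))"
    proof (rule AE_I2)
      fix y
      have "f y \<le> C * (1 + norm y powr m)" by (rule C)
      also have "\<dots> \<le> C * ((1 + exp (m\<^sup>2 / (4 * (\<epsilon>/2)))) * exp (\<epsilon>/2 * (norm y)\<^sup>2))"
        using C \<epsilon> by (intro mult_left_mono one_plus_powr_le_gaussian) auto
      finally have "f y \<le> B * exp (\<epsilon>/2 * (norm y)\<^sup>2)"
        by (simp add: B_def)
      then have "exp (- \<epsilon> * (norm y)\<^sup>2) * f y \<le> exp (- \<epsilon> * (norm y)\<^sup>2) * (B * exp (\<epsilon>/2 * (norm y)\<^sup>2))"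
        by (intro mult_left_mono) auto
      also have "\<dots> = B * (exp (- \<epsilon> * (norm y)\<^sup>2) * exp (\<epsilon>/2 * (norm y)\<^sup>2))" by simp
      also have "\<dots> = B * exp (- (\<epsilon>/2) * (norm y)\<^sup>2)"
        unfolding exp_add[symmetric] by (simp add: field_simps)
      finally show "norm (exp (- \<epsilon> * (norm y)\<^sup>2) * f y) \<le> norm (B * exp (- (\<epsilon>/2) * (norm y)\<^sup>2))"
        using f0[of y] C by (simp add: B_def abs_mult)
    qed
  qed
qed

section \<open>Convolution of f with kernels dominated by the heat kernel\<close>

definition heat_conv ::
    "(real \<Rightarrow> real ^ 'n \<Rightarrow> real) \<Rightarrow> (real ^ 'n \<Rightarrow> real) \<Rightarrow> real \<Rightarrow> real ^ 'n \<Rightarrow> real" where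
  "heat_conv K f t x = (LINT y|lebesgue. K t (x - y) * f y)"

text \<open>A class containing the heat kernel and all its derivatives used here, so that each
  analytic fact is proved once. The quadratic factor matches the highest degree among their
  polynomial factors; continuity of \<open>b\<close> makes it bounded on compact time
  intervals.\<close>

definition heat_dominated :: "(real \<Rightarrow> real ^ 'n \<Rightarrow> real) \<Rightarrow> bool" where
  "heat_dominated K \<longleftrightarrow> continuous_on ({0<..} \<times> UNIV) (\<lambda>(t, w). K t w) \<and>
     (\<exists>b. continuous_on {0<..} b \<and>
       (\<forall>t>0. \<forall>w. \<bar>K t w\<bar> \<le> b t * (1 + (norm w)\<^sup>2) * heat_kernel t w))"

lemma heat_kernel_nonneg: "heat_kernel t w \<ge> 0"
  by (simp add: heat_kernel_def)

lemma heat_kernel_eq_exp: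
  fixes w :: "real ^ 'n"
  assumes "t > 0"
  shows "heat_kernel t w = exp (- (real CARD('n) / 2) * ln (4 * pi * t) - (norm w)\<^sup>2 / (4 * t))"
  using assms by (simp add: heat_kernel_def powr_def exp_diff exp_minus inverse_eq_divide)

text \<open>One \<open>g\<close> must serve all (s, z) near (t, x), here with s between t/2 and 2 t
  and z within distance \<open>R\<close> of the origin. The Gaussian decay is spent in two
  instalments: part absorbs the quadratic factor, and part pays for replacing w = z - y by
  y.\<close>

lemma heat_dominated_integrable_bound:
  fixes K :: "real \<Rightarrow> real ^ 'n \<Rightarrow> real"
  assumes K: "heat_dominated K" and f: "gauss_integrable f" and t: "t > 0"
  shows "\<exists>g. integrable lebesgue g \<and>
     (\<forall>\<^sub>F q in nhds (t, x). fst q > 0 \<and> (\<forall>y. \<bar>K (fst q) (snd q - y) * f y\<bar> \<le> g y))"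
proof -
  obtain b where b: "continuous_on {0<..} b"
    "\<And>t w. t > 0 \<Longrightarrow> \<bar>K t w\<bar> \<le> b t * (1 + (norm w)\<^sup>2) * heat_kernel t w"
    using K unfolding heat_dominated_def by blast
  define \<tau> T R where "\<tau> = t / 2" and "T = 2 * t" and "R = norm x + 1"
  have pos: "\<tau> > 0" "T > 0" using t by (auto simp: \<tau>_def T_def)
  define N where "N = real CARD('n) / 2"
  have "compact (b ` {\<tau>..T})"
    by (intro compact_continuous_image continuous_on_subset[OF b(1)]) (use pos in auto)
  then obtain A where A: "A > 0" "\<And>s. s \<in> {\<tau>..T} \<Longrightarrow> \<bar>b s\<bar> \<le> A"
    by (auto dest!: compact_imp_bounded simp: bounded_pos)
  \<comment> \<open>Of the decay |w|^2/(4 T), half is used up by the quadratic factor. The remaining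
    |w|^2/(8 T) is at least |y|^2/(16 T) - R^2/(8 T), because |y|^2 <= 2 |w|^2 + 2 R^2.\<close>
  define \<epsilon> where "\<epsilon> = 1 / (16 * T)"
  have \<epsilon>: "\<epsilon> > 0" using pos by (simp add: \<epsilon>_def)
  define B where "B = A * (1 + 8 * T) * exp (- N * ln (4 * pi * \<tau>)) * exp (2 * \<epsilon> * R\<^sup>2)"
  define g where "g y = B * \<bar>exp (- \<epsilon> * (norm y)\<^sup>2) * f y\<bar>" for y
  have "integrable lebesgue g"
    using f \<epsilon> unfolding g_def gauss_integrable_def
    by (intro integrable_mult_right integrable_abs) auto
  moreover have bound: "\<bar>K s (z - y) * f y\<bar> \<le> g y"
    if "s \<in> {\<tau>..T}" "norm z \<le> R" for s z y
  proof -
    define w where "w = z - y"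
    have s: "s > 0" using that pos by auto
    have poly: "1 + (norm w)\<^sup>2 \<le> (1 + 8 * T) * exp ((norm w)\<^sup>2 / (8 * T))"
    proof -
      have "1 \<le> exp ((norm w)\<^sup>2 / (8 * T))" using pos by simp
      moreover have "(norm w)\<^sup>2 \<le> 8 * T * exp ((norm w)\<^sup>2 / (8 * T))"
        using exp_ge_add_one_self[of "(norm w)\<^sup>2 / (8 * T)"] pos by (simp add: field_simps)
      ultimately show ?thesis unfolding distrib_right by linarith
    qed
    have kernel: "heat_kernel s w \<le> exp (- N * ln (4 * pi * \<tau>)) * exp (- (norm w)\<^sup>2 / (4 * T))"
    proof -
      have "N * ln (4 * pi * \<tau>) \<le> N * ln (4 * pi * s)"
        using that pos by (intro mult_left_mono) (auto simp: N_def)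
      moreover have "(norm w)\<^sup>2 / (4 * T) \<le> (norm w)\<^sup>2 / (4 * s)"
        using that s by (intro divide_left_mono) auto
      ultimately show ?thesis
        unfolding heat_kernel_eq_exp[OF s] exp_add[symmetric] N_def[symmetric] by simp
    qed
    have gauss: "exp ((norm w)\<^sup>2 / (8 * T)) * exp (- (norm w)\<^sup>2 / (4 * T))
        \<le> exp (2 * \<epsilon> * R\<^sup>2) * exp (- \<epsilon> * (norm y)\<^sup>2)"
    proof -
      have "norm y \<le> norm w + norm z"
        unfolding w_def by (metis add.commute norm_minus_commute norm_triangle_sub)
      also have "\<dots> \<le> norm w + R" using that by simp
      finally have "(norm y)\<^sup>2 \<le> (norm w + R)\<^sup>2" by (intro power_mono) auto
      also have "\<dots> \<le> 2 * (norm w)\<^sup>2 + 2 * R\<^sup>2"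
        using sum_squares_bound[of "norm w" R] by (simp add: power2_sum)
      finally have "\<epsilon> * (norm y)\<^sup>2 \<le> \<epsilon> * (2 * (norm w)\<^sup>2 + 2 * R\<^sup>2)"
        using \<epsilon> by (intro mult_left_mono) auto
      then have "(norm w)\<^sup>2 / (8 * T) + - (norm w)\<^sup>2 / (4 * T) \<le> 2 * \<epsilon> * R\<^sup>2 + - \<epsilon> * (norm y)\<^sup>2"
        using pos by (simp add: \<epsilon>_def field_simps)
      then show ?thesis unfolding exp_add[symmetric] by simp
    qed
    have "\<bar>K s w\<bar> \<le> b s * (1 + (norm w)\<^sup>2) * heat_kernel s w"
      by (rule b(2)[OF s])
    also have "\<dots> \<le> A * ((1 + 8 * T) * exp ((norm w)\<^sup>2 / (8 * T))) *
        (exp (- N * ln (4 * pi * \<tau>)) * exp (- (norm w)\<^sup>2 / (4 * T)))"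
      using A(1) A(2)[OF that(1)] pos
      by (intro mult_mono poly kernel) (auto simp: heat_kernel_nonneg)
    also have "\<dots> = A * (1 + 8 * T) * exp (- N * ln (4 * pi * \<tau>)) *
        (exp ((norm w)\<^sup>2 / (8 * T)) * exp (- (norm w)\<^sup>2 / (4 * T)))"
      by simp
    also have "\<dots> \<le> A * (1 + 8 * T) * exp (- N * ln (4 * pi * \<tau>)) *
        (exp (2 * \<epsilon> * R\<^sup>2) * exp (- \<epsilon> * (norm y)\<^sup>2))"
      using A(1) pos by (intro mult_left_mono gauss) auto
    finally have "\<bar>K s w\<bar> \<le> B * exp (- \<epsilon> * (norm y)\<^sup>2)"
      by (simp add: B_def mult_ac)
    then have "\<bar>K s w\<bar> * \<bar>f y\<bar> \<le> B * exp (- \<epsilon> * (norm y)\<^sup>2) * \<bar>f y\<bar>"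
      by (intro mult_right_mono) auto
    then show ?thesis by (simp add: g_def w_def abs_mult mult_ac)
  qed
  moreover have "\<forall>\<^sub>F q in nhds (t, x). fst q \<in> {\<tau><..<T} \<and> snd q \<in> ball 0 R"
  proof (rule eventually_nhds_in_open[of "{\<tau><..<T} \<times> ball 0 R", THEN eventually_mono])
    show "open ({\<tau><..<T} \<times> ball (0::real^'n) R)" by (intro open_Times) auto
    show "(t, x) \<in> {\<tau><..<T} \<times> ball 0 R" using t by (auto simp: \<tau>_def T_def R_def)
  qed auto
  then have "\<forall>\<^sub>F q in nhds (t, x). fst q > 0 \<and> (\<forall>y. \<bar>K (fst q) (snd q - y) * f y\<bar> \<le> g y)"
    by eventually_elim (use pos bound in auto)
  ultimately show ?thesis by blast
qed

lemma heat_conv_measurable: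
  fixes K :: "real \<Rightarrow> real ^ 'n \<Rightarrow> real"
  assumes K: "heat_dominated K" and f: "gauss_integrable f" and t: "t > 0"
  shows "(\<lambda>y. K t (x - y) * f y) \<in> borel_measurable lebesgue"
proof -
  have "continuous_on ({0<..} \<times> UNIV) (\<lambda>(t, w). K t w)"
    using K by (simp add: heat_dominated_def)
  then have "continuous_on UNIV (\<lambda>y. (\<lambda>(t, w). K t w) (t, x - y))"
    by (rule continuous_on_compose2) (use t in \<open>auto intro!: continuous_intros\<close>)
  then have "(\<lambda>y. K t (x - y)) \<in> borel_measurable borel"
    by (intro borel_measurable_continuous_onI) simp
  then have "(\<lambda>y. K t (x - y)) \<in> borel_measurable lebesgue"
    by (intro measurable_completion) simp
  then show ?thesis
    using f unfolding gauss_integrable_def by auto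
qed

lemma heat_conv_integrable:
  fixes K :: "real \<Rightarrow> real ^ 'n \<Rightarrow> real"
  assumes K: "heat_dominated K" and f: "gauss_integrable f" and t: "t > 0"
  shows "integrable lebesgue (\<lambda>y. K t (x - y) * f y)"
proof -
  obtain g where g: "integrable lebesgue g"
    "\<forall>\<^sub>F q in nhds (t, x). fst q > 0 \<and> (\<forall>y. \<bar>K (fst q) (snd q - y) * f y\<bar> \<le> g y)"
    using heat_dominated_integrable_bound[OF assms] by blast
  from eventually_nhds_x_imp_x[OF g(2)]
  show ?thesis
    by (intro Bochner_Integration.integrable_bound[OF g(1) heat_conv_measurable[OF assms]])
       (auto intro!: AE_I2 intro: order_trans[OF _ abs_ge_self])
qed

lemma continuous_on_heat_conv:
  fixes K :: "real \<Rightarrow> real ^ 'n \<Rightarrow> real"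
  assumes K: "heat_dominated K" and f: "gauss_integrable f"
  shows "continuous_on ({0<..} \<times> UNIV) (\<lambda>(t, x). heat_conv K f t x)"
  unfolding continuous_on_def
proof
  fix p :: "real \<times> (real ^ 'n)" assume p: "p \<in> {0<..} \<times> UNIV"
  obtain t x where tx: "p = (t, x)" "t > 0" using p by auto
  obtain g where g: "integrable lebesgue g"
    "\<forall>\<^sub>F q in nhds p. fst q > 0 \<and> (\<forall>y. \<bar>K (fst q) (snd q - y) * f y\<bar> \<le> g y)"
    using heat_dominated_integrable_bound[OF assms tx(2)] tx(1) by blast
  have "((\<lambda>q. LINT y|lebesgue. K (fst q) (snd q - y) * f y) \<longlongrightarrow>
      (LINT y|lebesgue. K (fst p) (snd p - y) * f y)) (at p within {0<..} \<times> UNIV)"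
  proof (rule tendsto_integral_dominated[OF _ _ g(1)])
    have "\<forall>\<^sub>F q in at p within {0<..} \<times> UNIV. fst q > 0 \<and> (\<forall>y. \<bar>K (fst q) (snd q - y) * f y\<bar> \<le> g y)"
      using g(2) by (simp add: eventually_at_filter eventually_mono)
    then show "\<forall>\<^sub>F q in at p within {0<..} \<times> UNIV.
        (\<lambda>y. K (fst q) (snd q - y) * f y) \<in> borel_measurable lebesgue \<and>
        (\<forall>y. \<bar>K (fst q) (snd q - y) * f y\<bar> \<le> g y)"
      by eventually_elim (auto intro: heat_conv_measurable[OF assms])
    show "(\<lambda>y. K (fst p) (snd p - y) * f y) \<in> borel_measurable lebesgue"
      using tx by (simp add: heat_conv_measurable[OF assms])
    fix y
    have "continuous_on ({0<..} \<times> UNIV) (\<lambda>(t, w). K t w)"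
      using K by (simp add: heat_dominated_def)
    then have "continuous_on ({0<..} \<times> UNIV) (\<lambda>q. (\<lambda>(t, w). K t w) (fst q, snd q - y))"
      by (rule continuous_on_compose2) (auto intro!: continuous_intros)
    then have "continuous_on ({0<..} \<times> UNIV) (\<lambda>q. K (fst q) (snd q - y))"
      by simp
    then show "((\<lambda>q. K (fst q) (snd q - y) * f y) \<longlongrightarrow> K (fst p) (snd p - y) * f y)
        (at p within {0<..} \<times> UNIV)"
      using p unfolding continuous_on_def by (intro tendsto_mult tendsto_const) blast
  qed
  then show "((\<lambda>(t, x). heat_conv K f t x) \<longlongrightarrow> (case p of (t, x) \<Rightarrow> heat_conv K f t x))
      (at p within {0<..} \<times> UNIV)"
    by (simp add: heat_conv_def case_prod_unfold)
qed

text \<open>A curve (p, q) in space-time covers both uses: p moving with q fixed gives the time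
  derivative, p fixed with q moving along an axis gives the partial derivatives. The kernel K' is
  the derivative of K along that curve.\<close>

lemma heat_conv_has_derivative_along:
  fixes K :: "real \<Rightarrow> real ^ 'n \<Rightarrow> real" and p :: "real \<Rightarrow> real" and q :: "real \<Rightarrow> real ^ 'n"
  assumes K: "heat_dominated K" and K': "heat_dominated K'" and f: "gauss_integrable f"
    and cont: "isCont p a" "isCont q a" and pos: "p a > 0"
    and der: "\<And>s y. p s > 0 \<Longrightarrow>
      ((\<lambda>s. K (p s) (q s - y)) has_real_derivative K' (p s) (q s - y)) (at s)"
  shows "((\<lambda>s. heat_conv K f (p s) (q s)) has_real_derivative heat_conv K' f (p a) (q a)) (at a)"
proof -
  obtain g where g: "integrable lebesgue g"
    "\<forall>\<^sub>F r in nhds (p a, q a). fst r > 0 \<and> (\<forall>y. \<bar>K' (fst r) (snd r - y) * f y\<bar> \<le> g y)"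
    using heat_dominated_integrable_bound[OF K' f pos] by blast
  have "((\<lambda>s. (p s, q s)) \<longlongrightarrow> (p a, q a)) (nhds a)"
    using cont by (intro tendsto_Pair) (auto simp: continuous_at_imp_continuous_at_within isCont_def tendsto_nhds_iff)
  \<comment> \<open>Continuity of the curve pulls the domination near (p a, q a) back to an interval
    around a.\<close>
  from filterlim_iff[THEN iffD1, OF this, rule_format, OF g(2)]
  obtain \<delta> where \<delta>: "\<delta> > 0" "\<And>s. \<bar>s - a\<bar> < \<delta> \<Longrightarrow> p s > 0"
    "\<And>s y. \<bar>s - a\<bar> < \<delta> \<Longrightarrow> \<bar>K' (p s) (q s - y) * f y\<bar> \<le> g y"
    by (auto simp: eventually_nhds_metric dist_real_def)
  show ?thesis
    unfolding heat_conv_def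
  proof (rule has_real_derivative_integral_dominated[OF \<delta>(1) g(1)])
    show "((\<lambda>s. K (p s) (q s - y) * f y) has_real_derivative K' (p s) (q s - y) * f y) (at s)"
      if "\<bar>s - a\<bar> < \<delta>" for s y
      using der[OF \<delta>(2)[OF that]] by (rule DERIV_cmult_right)
  qed (use \<delta> pos in \<open>auto intro: heat_conv_integrable[OF K f] heat_conv_measurable[OF K' f]\<close>)
qed

section \<open>Derivatives of the heat kernel and the heat equation\<close>

definition heat_kernel_dt :: "real \<Rightarrow> real ^ 'n \<Rightarrow> real" where
  "heat_kernel_dt t w = ((norm w)\<^sup>2 / (4 * t\<^sup>2) - real CARD('n) / (2 * t)) * heat_kernel t w"

definition heat_kernel_dx :: "'n \<Rightarrow> real \<Rightarrow> real ^ 'n \<Rightarrow> real" where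
  "heat_kernel_dx i t w = - (w $ i / (2 * t)) * heat_kernel t w"

definition heat_kernel_dxx :: "'n \<Rightarrow> real \<Rightarrow> real ^ 'n \<Rightarrow> real" where
  "heat_kernel_dxx i t w = ((w $ i)\<^sup>2 / (4 * t\<^sup>2) - 1 / (2 * t)) * heat_kernel t w"

lemma continuous_on_heat_kernel:
  "continuous_on ({0<..} \<times> UNIV) (\<lambda>(t, w). heat_kernel t w)"
  unfolding heat_kernel_def case_prod_unfold by (intro continuous_intros) auto

lemma heat_dominatedI:
  assumes "continuous_on ({0<..} \<times> UNIV) (\<lambda>(t, w). h t w)" and "continuous_on {0<..} b"
    and "\<And>t w. t > 0 \<Longrightarrow> \<bar>h t w\<bar> \<le> b t * (1 + (norm w)\<^sup>2)"
  shows "heat_dominated (\<lambda>t w. h t w * heat_kernel t w)"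
  unfolding heat_dominated_def
proof (intro conjI exI[of _ b] allI impI assms(2))
  show "continuous_on ({0<..} \<times> UNIV) (\<lambda>(t, w). h t w * heat_kernel t w)"
    using continuous_on_mult[OF assms(1) continuous_on_heat_kernel]
    by (simp add: case_prod_unfold)
  show "\<bar>h t w * heat_kernel t w\<bar> \<le> b t * (1 + (norm w)\<^sup>2) * heat_kernel t w" if "t > 0" for t w
    using mult_right_mono[OF assms(3)[OF that] heat_kernel_nonneg]
    by (simp add: abs_mult heat_kernel_nonneg)
qed

lemma heat_dominated_heat_kernel: "heat_dominated heat_kernel"
  using heat_dominatedI[of "\<lambda>t w. 1" "\<lambda>t. 1"] by simp

lemma heat_dominated_heat_kernel_dt:
  "heat_dominated (heat_kernel_dt :: real \<Rightarrow> real ^ 'n \<Rightarrow> real)"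
  unfolding heat_kernel_dt_def[abs_def]
proof (rule heat_dominatedI)
  show "continuous_on ({0<..} \<times> UNIV)
      (\<lambda>(t, w :: real ^ 'n). (norm w)\<^sup>2 / (4 * t\<^sup>2) - real CARD('n) / (2 * t))"
    unfolding case_prod_unfold by (intro continuous_intros) auto
  show "continuous_on {0<..} (\<lambda>t. 1 / (4 * t\<^sup>2) + real CARD('n) / (2 * t))"
    by (intro continuous_intros) auto
  fix t :: real and w :: "real ^ 'n" assume t: "t > 0"
  have "\<bar>(norm w)\<^sup>2 / (4 * t\<^sup>2) - real CARD('n) / (2 * t)\<bar> \<le>
      \<bar>(norm w)\<^sup>2 / (4 * t\<^sup>2)\<bar> + \<bar>real CARD('n) / (2 * t)\<bar>"
    by (rule abs_triangle_ineq4)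
  also have "\<dots> = 1 / (4 * t\<^sup>2) * (norm w)\<^sup>2 + real CARD('n) / (2 * t) * 1"
    using t by simp
  also have "\<dots> \<le> 1 / (4 * t\<^sup>2) * (1 + (norm w)\<^sup>2) + real CARD('n) / (2 * t) * (1 + (norm w)\<^sup>2)"
    using t by (intro add_mono mult_left_mono) auto
  finally show "\<bar>(norm w)\<^sup>2 / (4 * t\<^sup>2) - real CARD('n) / (2 * t)\<bar> \<le>
      (1 / (4 * t\<^sup>2) + real CARD('n) / (2 * t)) * (1 + (norm w)\<^sup>2)"
    by (simp add: distrib_right)
qed

lemma heat_dominated_heat_kernel_dx:
  fixes i :: "'n::finite"
  shows "heat_dominated (heat_kernel_dx i)"
  unfolding heat_kernel_dx_def[abs_def]
proof (rule heat_dominatedI)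
  show "continuous_on ({0<..} \<times> UNIV) (\<lambda>(t, w :: real ^ 'n). - (w $ i / (2 * t)))"
    unfolding case_prod_unfold by (intro continuous_intros) auto
  show "continuous_on {0<..} (\<lambda>t::real. 1 / (2 * t))"
    by (intro continuous_intros) auto
  fix t :: real and w :: "real ^ 'n" assume t: "t > 0"
  have "\<bar>w $ i\<bar> \<le> norm w" by (rule component_le_norm_cart)
  also have "norm w \<le> 1 + (norm w)\<^sup>2"
    \<comment> \<open>Expanding (|w| - 1)^2 >= 0 gives 2 |w| <= 1 + |w|^2.\<close>
    using zero_le_power2[of "norm w - 1"] norm_ge_zero[of w] unfolding power2_diff power_one by linarith
  finally show "\<bar>- (w $ i / (2 * t))\<bar> \<le> 1 / (2 * t) * (1 + (norm w)\<^sup>2)"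
    using t by (simp add: divide_right_mono)
qed

lemma heat_dominated_heat_kernel_dxx:
  fixes i :: "'n::finite"
  shows "heat_dominated (heat_kernel_dxx i)"
  unfolding heat_kernel_dxx_def[abs_def]
proof (rule heat_dominatedI)
  show "continuous_on ({0<..} \<times> UNIV)
      (\<lambda>(t, w :: real ^ 'n). (w $ i)\<^sup>2 / (4 * t\<^sup>2) - 1 / (2 * t))"
    unfolding case_prod_unfold by (intro continuous_intros) auto
  show "continuous_on {0<..} (\<lambda>t::real. 1 / (4 * t\<^sup>2) + 1 / (2 * t))"
    by (intro continuous_intros) auto
  fix t :: real and w :: "real ^ 'n" assume t: "t > 0"
  have wi: "(w $ i)\<^sup>2 \<le> (norm w)\<^sup>2"
    by (rule abs_le_square_iff[THEN iffD1]) (simp add: component_le_norm_cart)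
  have "\<bar>(w $ i)\<^sup>2 / (4 * t\<^sup>2) - 1 / (2 * t)\<bar> \<le> \<bar>(w $ i)\<^sup>2 / (4 * t\<^sup>2)\<bar> + \<bar>1 / (2 * t)\<bar>"
    by (rule abs_triangle_ineq4)
  also have "\<dots> = 1 / (4 * t\<^sup>2) * (w $ i)\<^sup>2 + 1 / (2 * t) * 1"
    using t by simp
  also have "\<dots> \<le> 1 / (4 * t\<^sup>2) * (1 + (norm w)\<^sup>2) + 1 / (2 * t) * (1 + (norm w)\<^sup>2)"
    using t wi by (intro add_mono mult_left_mono) auto
  finally show "\<bar>(w $ i)\<^sup>2 / (4 * t\<^sup>2) - 1 / (2 * t)\<bar> \<le>
      (1 / (4 * t\<^sup>2) + 1 / (2 * t)) * (1 + (norm w)\<^sup>2)"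
    by (simp add: distrib_right)
qed

text \<open>For positive times the power prefactor can be absorbed into a single exponential, which
  is simpler to differentiate.\<close>

lemma heat_kernel_has_derivative_time:
  fixes w :: "real ^ 'n"
  assumes t: "t > 0"
  shows "((\<lambda>s. heat_kernel s w) has_real_derivative heat_kernel_dt t w) (at t)"
proof (rule has_field_derivative_transform_within_open[of _ _ _ "{0<..}"])
  show "((\<lambda>s. exp (- (real CARD('n) / 2) * ln (4 * pi * s) - (norm w)\<^sup>2 / (4 * s)))
      has_real_derivative heat_kernel_dt t w) (at t)"
    using t by (auto intro!: derivative_eq_intros
        simp: heat_kernel_dt_def heat_kernel_eq_exp field_simps power2_eq_square)
qed (use t in \<open>auto simp: heat_kernel_eq_exp\<close>)

text \<open>Makes the exponent of the kernel a polynomial in s, so no derivative of the norm itself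
  has to be taken.\<close>

lemma norm_add_axis_square:
  fixes w :: "real ^ 'n"
  shows "(norm (w + s *\<^sub>R axis i 1))\<^sup>2 = (norm w)\<^sup>2 + 2 * s * w $ i + s\<^sup>2"
  unfolding power2_norm_eq_inner
  by (simp add: inner_add_left inner_add_right inner_axis inner_axis' inner_axis_axis power2_eq_square
      distrib_left)

lemma heat_kernel_has_derivative_axis:
  fixes w :: "real ^ 'n"
  assumes t: "t > 0"
  shows "((\<lambda>s. heat_kernel t (w + s *\<^sub>R axis i 1)) has_real_derivative
    heat_kernel_dx i t (w + s *\<^sub>R axis i 1)) (at s)"
  unfolding heat_kernel_dx_def heat_kernel_def norm_add_axis_square
  using t by (auto intro!: derivative_eq_intros simp: field_simps)

lemma heat_kernel_dx_has_derivative_axis: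
  fixes w :: "real ^ 'n"
  assumes t: "t > 0"
  shows "((\<lambda>s. heat_kernel_dx i t (w + s *\<^sub>R axis i 1)) has_real_derivative
    heat_kernel_dxx i t (w + s *\<^sub>R axis i 1)) (at s)"
proof -
  have "((\<lambda>s. - ((w + s *\<^sub>R axis i 1) $ i / (2 * t)) * heat_kernel t (w + s *\<^sub>R axis i 1))
      has_real_derivative - (1 / (2 * t)) * heat_kernel t (w + s *\<^sub>R axis i 1) +
       heat_kernel_dx i t (w + s *\<^sub>R axis i 1) * - ((w + s *\<^sub>R axis i 1) $ i / (2 * t))) (at s)"
    by (rule DERIV_mult'[OF _ heat_kernel_has_derivative_axis[OF t], THEN DERIV_cong])
       (use t in \<open>auto intro!: derivative_eq_intros\<close>)
  then show ?thesis
    unfolding heat_kernel_dx_def[abs_def] heat_kernel_dxx_def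
    by (rule DERIV_cong) (use t in \<open>simp add: field_simps power2_eq_square\<close>)
qed

text \<open>The heat equation for the kernel: the squares of the coordinates add up to |w|^2, and
  the n terms 1/(2 t) to n/(2 t).\<close>

lemma sum_heat_kernel_dxx:
  fixes w :: "real ^ 'n"
  shows "(\<Sum>i\<in>UNIV. heat_kernel_dxx i t w) = heat_kernel_dt t w"
  unfolding heat_kernel_dxx_def heat_kernel_dt_def sum_distrib_right[symmetric] power2_norm_eq_inner
  by (simp add: sum_subtractf sum_divide_distrib[symmetric] inner_vec_def power2_eq_square)

section \<open>Derivatives of the regularization, in space-time and along a branch\<close>

lemma heat_reg_eq_heat_conv: "heat_reg t f = heat_conv heat_kernel f t"
  by (simp add: heat_reg_def heat_conv_def fun_eq_iff)

context
  fixes f :: "real ^ 'n \<Rightarrow> real"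
  assumes f: "gauss_integrable f"
begin

lemma heat_reg_has_derivative_time:
  assumes "t > 0"
  shows "((\<lambda>s. heat_reg s f x) has_real_derivative heat_conv heat_kernel_dt f t x) (at t)"
  unfolding heat_reg_eq_heat_conv
  using heat_conv_has_derivative_along[OF heat_dominated_heat_kernel heat_dominated_heat_kernel_dt f,
      where p="\<lambda>s. s" and a=t and q="\<lambda>s. x"] assms
  by (auto intro: heat_kernel_has_derivative_time)

lemma heat_reg_has_derivative_axis:
  assumes "t > 0"
  shows "((\<lambda>s. heat_reg t f (x + s *\<^sub>R axis i 1)) has_real_derivative
    heat_conv (heat_kernel_dx i) f t x) (at 0)"
  unfolding heat_reg_eq_heat_conv
  using heat_conv_has_derivative_along[OF heat_dominated_heat_kernel heat_dominated_heat_kernel_dx f,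
      where p="\<lambda>s. t" and a=0 and q="\<lambda>s. x + s *\<^sub>R axis i 1"] assms
    heat_kernel_has_derivative_axis[OF assms, of "x - _" i]
  by (simp add: add_diff_eq[symmetric] add.commute diff_add_eq)

text \<open>Being an identity of functions, it presents the first partial derivative as another
  \<open>heat_conv\<close>, ready to be differentiated once more.\<close>

lemma partial_deriv_heat_reg:
  assumes "t > 0"
  shows "partial_deriv i (heat_reg t f) = heat_conv (heat_kernel_dx i) f t"
  unfolding partial_deriv_def fun_eq_iff
  using heat_reg_has_derivative_axis[OF assms] by (auto intro: DERIV_imp_deriv)

lemma partial_deriv_heat_reg_has_derivative_axis:
  assumes "t > 0"
  shows "((\<lambda>s. partial_deriv i (heat_reg t f) (x + s *\<^sub>R axis i 1)) has_real_derivative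
    heat_conv (heat_kernel_dxx i) f t x) (at 0)"
  unfolding partial_deriv_heat_reg[OF assms]
  using heat_conv_has_derivative_along[OF heat_dominated_heat_kernel_dx heat_dominated_heat_kernel_dxx f,
      where p="\<lambda>s. t" and a=0 and q="\<lambda>s. x + s *\<^sub>R axis i 1"] assms
    heat_kernel_dx_has_derivative_axis[OF assms, of i "x - _"]
  by (simp add: add_diff_eq[symmetric] add.commute diff_add_eq)

lemma has_pure_second_partials_heat_reg:
  assumes "t > 0"
  shows "has_pure_second_partials (heat_reg t f) x"
  unfolding has_pure_second_partials_def real_differentiable_def
  by (intro allI conjI always_eventually exI)
     (rule heat_reg_has_derivative_axis[OF assms] partial_deriv_heat_reg_has_derivative_axis[OF assms])+

lemma laplacian_heat_reg:
  assumes "t > 0"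
  shows "laplacian (heat_reg t f) x = heat_conv heat_kernel_dt f t x"
proof -
  have "laplacian (heat_reg t f) x = (\<Sum>i\<in>UNIV. heat_conv (heat_kernel_dxx i) f t x)"
    \<comment> \<open>Only the outer \<open>partial_deriv\<close> is unfolded; the inner one has to
      match \<open>partial_deriv_heat_reg_has_derivative_axis\<close>.\<close>
    unfolding laplacian_def partial_deriv_def[of _ "partial_deriv _ _"]
    using partial_deriv_heat_reg_has_derivative_axis[OF assms]
    by (intro sum.cong) (auto intro: DERIV_imp_deriv)
  also have "\<dots> = (LINT y|lebesgue. (\<Sum>i\<in>UNIV. heat_kernel_dxx i t (x - y) * f y))"
    unfolding heat_conv_def
    by (rule Bochner_Integration.integral_sum[symmetric])
       (rule heat_conv_integrable[OF heat_dominated_heat_kernel_dxx f assms])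
  also have "\<dots> = heat_conv heat_kernel_dt f t x"
    by (simp add: heat_conv_def sum_distrib_right[symmetric] sum_heat_kernel_dxx)
  finally show ?thesis .
qed

text \<open>With u(t, y) for the regularization at time t, the increment of the energy splits as
  [u(s, x s) - u(t, x s)] + [u(t, x s) - u(t, x t)]. The mean value theorem in time and joint
  continuity of the time derivative handle the first bracket; the second is o(s - t) because the
  gradient vanishes at x t. Joint differentiability of u is never needed.\<close>

lemma heat_reg_along_branch:
  assumes J: "J \<subseteq> {0<..}" and t: "t \<in> J"
    and x: "(x has_vector_derivative x') (at t within J)"
    and crit: "GDERIV (heat_reg t f) (x t) :> 0"
  shows "((\<lambda>s. heat_reg s f (x s)) has_real_derivative heat_conv heat_kernel_dt f t (x t))
    (at t within J)"
proof -
  let ?W = "heat_conv heat_kernel_dt f"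
  have t0: "t > 0" using J t by auto
  have x_cont: "(x \<longlongrightarrow> x t) (at t within J)"
    using has_vector_derivative_continuous[OF x] by (simp add: continuous_within)
  have "((\<lambda>s. heat_reg t f (x s)) has_derivative (\<lambda>h. inner (h *\<^sub>R x') 0)) (at t within J)"
    using has_derivative_compose[of x "\<lambda>h. h *\<^sub>R x'" t J "heat_reg t f" "\<lambda>h. inner h 0"] x crit
    by (simp add: has_vector_derivative_def gderiv_def)
  then have space: "((\<lambda>s. heat_reg t f (x s)) has_real_derivative 0) (at t within J)"
    by (simp add: has_field_derivative_def mult_zero_left[abs_def])
  \<comment> \<open>The mean value theorem in time, with the space point frozen at x s. The weak
    bound on \<xi> treats s < t, s = t and s > t alike, and it forces \<xi> to t as s tends to
    t.\<close>
  have "\<exists>\<xi>. \<bar>\<xi> - t\<bar> \<le> \<bar>s - t\<bar> \<and> \<xi> > 0 \<and>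
      heat_reg s f (x s) - heat_reg t f (x s) = (s - t) * ?W \<xi> (x s)" if s: "s > 0" for s
  proof (cases s t rule: linorder_cases)
    case less
    have "\<exists>z>s. z < t \<and> heat_reg t f (x s) - heat_reg s f (x s) = (t - s) * ?W z (x s)"
      by (rule MVT2[OF less]) (use s in \<open>auto intro: heat_reg_has_derivative_time\<close>)
    then obtain z where "z > s" "z < t"
      "heat_reg t f (x s) - heat_reg s f (x s) = (t - s) * ?W z (x s)"
      by blast
    then show ?thesis using s by (intro exI[of _ z]) (auto simp: algebra_simps)
  next
    case equal
    then show ?thesis using s by (intro exI[of _ t]) auto
  next
    case greater
    have "\<exists>z>t. z < s \<and> heat_reg s f (x s) - heat_reg t f (x s) = (s - t) * ?W z (x s)"
      by (rule MVT2[OF greater]) (use t0 in \<open>auto intro: heat_reg_has_derivative_time\<close>)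
    then obtain z where "z > t" "z < s"
      "heat_reg s f (x s) - heat_reg t f (x s) = (s - t) * ?W z (x s)"
      by blast
    then show ?thesis using t0 by (intro exI[of _ z]) auto
  qed
  then obtain \<xi> where \<xi>: "\<And>s. s > 0 \<Longrightarrow> \<bar>\<xi> s - t\<bar> \<le> \<bar>s - t\<bar>" "\<And>s. s > 0 \<Longrightarrow> \<xi> s > 0"
    "\<And>s. s > 0 \<Longrightarrow> heat_reg s f (x s) - heat_reg t f (x s) = (s - t) * ?W (\<xi> s) (x s)"
    by metis
  have nearJ: "\<forall>\<^sub>F s in at t within J. s > 0 \<and> s \<noteq> t"
    using J by (auto simp: eventually_at_filter intro!: always_eventually)
  have "(\<xi> \<longlongrightarrow> t) (at t within J)"
  proof (rule Lim_transform_bound[where g="\<lambda>s. s - t" and f="\<lambda>s. \<xi> s - t", THEN LIM_zero_cancel])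
    show "\<forall>\<^sub>F s in at t within J. norm (\<xi> s - t) \<le> norm (s - t)"
      using nearJ by eventually_elim (use \<xi>(1) in auto)
    show "((\<lambda>s. s - t) \<longlongrightarrow> 0) (at t within J)"
      by (auto intro!: tendsto_eq_intros)
  qed
  then have lim: "((\<lambda>s. (\<xi> s, x s)) \<longlongrightarrow> (t, x t)) (at t within J)"
    by (intro tendsto_Pair x_cont)
  have "isCont (\<lambda>(t, x). ?W t x) (t, x t)"
    using continuous_on_heat_conv[OF heat_dominated_heat_kernel_dt f] t0
    by (subst (asm) continuous_on_eq_continuous_at) (auto intro!: open_Times)
  from isCont_tendsto_compose[OF this lim]
  have "((\<lambda>s. ?W (\<xi> s) (x s)) \<longlongrightarrow> ?W t (x t)) (at t within J)" by simp
  then have "((\<lambda>s. (heat_reg s f (x s) - heat_reg t f (x s)) / (s - t)) \<longlongrightarrow> ?W t (x t)) (at t within J)"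
    by (rule Lim_transform_eventually)
       (use nearJ in eventually_elim, use \<xi>(3) in auto)
  then have "((\<lambda>s. heat_reg s f (x s) - heat_reg t f (x s)) has_real_derivative ?W t (x t)) (at t within J)"
    by (simp add: has_field_derivative_iff)
  \<comment> \<open>Adding the two brackets cancels u(t, x s) and leaves u(s, x s) - u(t, x t) up to
    a constant.\<close>
  from DERIV_add[OF this space] show ?thesis by simp
qed

end

theorem lemma4p10:
  fixes f :: "real ^ 'n \<Rightarrow> real"
    and J :: "real set"
    and x :: "real \<Rightarrow> real ^ 'n"
    and E :: "real \<Rightarrow> real"
  assumes "f \<in> borel_measurable lebesgue"
    and "quadratic_lower_bound f"
    and "local_profile f"
    and "polynomial_tail f"
    and "is_interval J" and "J \<subseteq> {0<..}"
    and "critical_point_branch f J x"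
    and "\<And>t. t \<in> J \<Longrightarrow> E t = heat_reg t f (x t)"
  shows "C1_on J E \<and>
    (\<forall>t\<in>J.
       (\<lambda>s. heat_reg s f (x t)) differentiable (at t) \<and>
       has_pure_second_partials (heat_reg t f) (x t) \<and>
       (E has_real_derivative deriv (\<lambda>s. heat_reg s f (x t)) t) (at t within J) \<and>
       deriv (\<lambda>s. heat_reg s f (x t)) t = laplacian (heat_reg t f) (x t))"
proof -
  have f: "gauss_integrable f"
    using assms(1,2,4) by (rule gauss_integrable_polynomial_tail)
  let ?W = "heat_conv heat_kernel_dt f"
  have pos: "t > 0" if "t \<in> J" for t using that assms(6) by auto
  obtain x' where x': "\<And>t. t \<in> J \<Longrightarrow> (x has_vector_derivative x' t) (at t within J)"
    and crit: "\<And>t. t \<in> J \<Longrightarrow> GDERIV (heat_reg t f) (x t) :> 0"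
    using assms(7) unfolding critical_point_branch_def C1_on_def by blast
  \<comment> \<open>\<open>E\<close> is prescribed on J alone, which suffices for a derivative
    within J; the radius 1 is arbitrary.\<close>
  have E: "(E has_real_derivative ?W t (x t)) (at t within J)" if "t \<in> J" for t
    by (rule has_field_derivative_transform_within[where d=1,
          OF heat_reg_along_branch[OF f assms(6) that x'[OF that] crit[OF that]]])
       (use that assms(8) in auto)
  have time: "((\<lambda>s. heat_reg s f (x t)) has_real_derivative ?W t (x t)) (at t)" if "t \<in> J" for t
    using heat_reg_has_derivative_time[OF f pos[OF that]] .
  have "continuous_on J x"
    using x' by (auto simp: continuous_on_eq_continuous_within intro: has_vector_derivative_continuous)
  \<comment> \<open>Continuity of E' is the joint continuity of \<open>?W\<close> composed with the
    continuous curve (t, x t).\<close>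
  then have "continuous_on J (\<lambda>t. (\<lambda>(t, x). ?W t x) (t, x t))"
    using assms(6)
    by (intro continuous_on_compose2[OF continuous_on_heat_conv[OF heat_dominated_heat_kernel_dt f]]
        continuous_intros) auto
  then have "C1_on J E"
    unfolding C1_on_def using E
    by (auto intro!: exI[of _ "\<lambda>t. ?W t (x t)"]
        simp: has_real_derivative_iff_has_vector_derivative)
  moreover have "deriv (\<lambda>s. heat_reg s f (x t)) t = ?W t (x t)" if "t \<in> J" for t
    using time[OF that] by (rule DERIV_imp_deriv)
  ultimately show ?thesis
    using E time pos laplacian_heat_reg[OF f] has_pure_second_partials_heat_reg[OF f]
    by (auto simp: real_differentiable_def)
qed

end
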